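(* Let $\mathcal A$ be the set of monomials in one variable $x_1$ corresponding to admissible decorated planar binary trees. Then $\mathcal A$ is a linear basis of the free one-generated initial pre-associative algebra $\mathrm{pre}\text{-}\mathrm{As}^{\mathrm I}\langle x_1\rangle$.
   Context: The ground field $\Bbbk$ has characteristic $0$. The nonsymmetric operad $\mathrm{pre}\text{-}\mathrm{As}^{\mathrm I}$ (initial pre-associative algebras) governs algebras with two bilinear operations $\prec,\succ$ satisfying $$(x_{1}\succ x_{2})\succ x_{3}+(x_{1}\prec x_{2})\succ x_{3}-x_{1}\succ(x_{2}\succ x_{3})+(x_{1}\prec x_{2})\prec x_{3}-x_{1}\prec(x_{2}\succ x_{3})-x_{1}\prec(x_{2}\prec x_{3})=0,$$ $$x_1\succ(x_2\prec x_3)=(x_1\succ x_2)\prec x_3.$$ Consider planar binary trees (every internal vertex has a left and a right child; the single leaf $*$ is allowed) whose leaves are unlabeled and whose internal vertices are labeled by $\bullet$ or $\circ$. Write $\alpha(L,R)$ for the tree with root label $\alpha$, left subtree $L$ and right subtree $R$. A tree is admissible if it contains no subtree of one of the forms $\bullet(\circ(\cdot,\cdot),\cdot)$, $\circ(\circ(\cdot,\cdot),\cdot)$, $\bullet(\bullet(\bullet(\cdot,\cdot),\cdot),\cdot)$, where the dots stand for arbitrary trees. The monomial corresponding to a tree is obtained by reading $\bullet$ as the operation $\prec$, $\circ$ as the operation $\succ$, and every leaf as $x_1$. *)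

theory Defs
  imports Complex_Main "HOL-Library.Poly_Mapping"
begin

section \<open>Initial pre-associative algebras\<close>

locale initial_pre_as = vector_space scale
  for scale :: "'k::field \<Rightarrow> 'a::ab_group_add \<Rightarrow> 'a" +
  fixes lprod :: "'a \<Rightarrow> 'a \<Rightarrow> 'a" (infix "\<prec>" 70)
    and rprod :: "'a \<Rightarrow> 'a \<Rightarrow> 'a" (infix "\<succ>" 70)
  assumes linear_lprod: "Vector_Spaces.linear scale scale (\<lambda>y. x \<prec> y)"
        "Vector_Spaces.linear scale scale (\<lambda>x. x \<prec> y)"
    and linear_rprod: "Vector_Spaces.linear scale scale (\<lambda>y. x \<succ> y)"
        "Vector_Spaces.linear scale scale (\<lambda>x. x \<succ> y)"
    and pre_as_rel1:
      "(x \<succ> y) \<succ> z + (x \<prec> y) \<succ> z - x \<succ> (y \<succ> z)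
        + (x \<prec> y) \<prec> z - x \<prec> (y \<succ> z) - x \<prec> (y \<prec> z) = 0"
    and pre_as_rel2: "x \<succ> (y \<prec> z) = (x \<succ> y) \<prec> z"


section \<open>Decorated planar binary trees\<close>

datatype label = Black | White

datatype dtree = Leaf | Node label dtree dtree

primrec subtrees :: "dtree \<Rightarrow> dtree set" where
  "subtrees Leaf = {Leaf}"
| "subtrees (Node a l r) = insert (Node a l r) (subtrees l \<union> subtrees r)"

definition admissible :: "dtree \<Rightarrow> bool" where
  "admissible t \<longleftrightarrow>
    (\<forall>t1 t2 t3. Node Black (Node White t1 t2) t3 \<notin> subtrees t) \<and>
    (\<forall>t1 t2 t3. Node White (Node White t1 t2) t3 \<notin> subtrees t) \<and>
    (\<forall>t1 t2 t3 t4. Node Black (Node Black (Node Black t1 t2) t3) t4 \<notin> subtrees t)"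

text \<open>Black vertices (\<open>\<bullet>\<close>) are read as \<open>\<prec>\<close> (argument \<open>lp\<close>), white ones (\<open>\<circ>\<close>) as \<open>\<succ>\<close>
  (argument \<open>rp\<close>), and leaves as \<open>x\<close>.\<close>

primrec eval_tree :: "('a \<Rightarrow> 'a \<Rightarrow> 'a) \<Rightarrow> ('a \<Rightarrow> 'a \<Rightarrow> 'a) \<Rightarrow> 'a \<Rightarrow> dtree \<Rightarrow> 'a" where
  "eval_tree lp rp x Leaf = x"
| "eval_tree lp rp x (Node a l r) =
    (case a of Black \<Rightarrow> lp | White \<Rightarrow> rp) (eval_tree lp rp x l) (eval_tree lp rp x r)"


section \<open>The free algebra with two bilinear operations on one generator\<close>

text \<open>Its basis is the set of all decorated trees: it is the space of finitely supported functions
  on trees, and the product \<open>magma_mult a\<close> is the bilinear extension of \<open>Node a\<close>.\<close>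

definition magma_scale :: "'k::field \<Rightarrow> (dtree \<Rightarrow>\<^sub>0 'k) \<Rightarrow> (dtree \<Rightarrow>\<^sub>0 'k)" where
  "magma_scale c = Poly_Mapping.map ((*) c)"

lift_definition magma_mult ::
  "label \<Rightarrow> (dtree \<Rightarrow>\<^sub>0 'k::field) \<Rightarrow> (dtree \<Rightarrow>\<^sub>0 'k) \<Rightarrow> (dtree \<Rightarrow>\<^sub>0 'k)"
  is "\<lambda>a p q t. case t of Leaf \<Rightarrow> 0 | Node b l r \<Rightarrow> if b = a then p l * q r else 0"
proof -
  fix a :: label and p q :: "dtree \<Rightarrow> 'k"
  assume "finite {t. p t \<noteq> 0}" "finite {t. q t \<noteq> 0}"
  then have "finite ((\<lambda>(l, r). Node a l r) ` ({t. p t \<noteq> 0} \<times> {t. q t \<noteq> 0}))" by simp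
  then show "finite {t. (case t of Leaf \<Rightarrow> 0
      | Node b l r \<Rightarrow> if b = a then p l * q r else 0) \<noteq> 0}"
    by (rule rev_finite_subset) (auto simp: image_iff split: dtree.split_asm if_splits)
qed

lemma lookup_magma_scale [simp]: "Poly_Mapping.lookup (magma_scale c p) t =
    c * Poly_Mapping.lookup p t"
  by (simp add: magma_scale_def Poly_Mapping.map.rep_eq when_def)

lemma lookup_magma_mult:
  "Poly_Mapping.lookup (magma_mult a p q) t =
    (case t of Leaf \<Rightarrow> 0 | Node b l r \<Rightarrow> if b = a then Poly_Mapping.lookup p l * Poly_Mapping.lookup q r else 0)"
  by transfer simp

lemma magma_mult_single:
  "magma_mult a (Poly_Mapping.single s 1) (Poly_Mapping.single t 1) =
    (Poly_Mapping.single (Node a s t) 1 :: dtree \<Rightarrow>\<^sub>0 'k::field)"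
  by (rule poly_mapping_eqI)
    (auto simp: lookup_magma_mult lookup_single when_def split: dtree.splits)

lemma magma_vector_space: "vector_space (magma_scale :: 'k::field \<Rightarrow> _)"
  by unfold_locales (auto intro!: poly_mapping_eqI simp: lookup_add algebra_simps)

lemma magma_mult_bilinear:
  "magma_mult a (p + p') q = magma_mult a p q + magma_mult a p' q"
  "magma_mult a p (q + q') = magma_mult a p q + magma_mult a p q'"
  "magma_mult a (p - p') q = magma_mult a p q - magma_mult a p' q"
  "magma_mult a p (q - q') = magma_mult a p q - magma_mult a p q'"
  "magma_mult a (magma_scale c p) q = magma_scale c (magma_mult a p q)"
  "magma_mult a p (magma_scale c q) = magma_scale c (magma_mult a p q)"
  by (auto intro!: poly_mapping_eqI
      simp: lookup_magma_mult lookup_add lookup_minus algebra_simps split: dtree.splits)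


section \<open>The free one-generated initial pre-associative algebra\<close>

text \<open>The quotient of the free algebra with two bilinear operations by the two-sided ideal generated
  by all substitution instances of the two defining identities. That it has the universal property
  is \<open>free_pre_as_universal\<close> below.\<close>

inductive_set pre_as_ideal :: "(dtree \<Rightarrow>\<^sub>0 'k::field) set" where
  zero: "0 \<in> pre_as_ideal"
| add: "p \<in> pre_as_ideal \<Longrightarrow> q \<in> pre_as_ideal \<Longrightarrow> p + q \<in> pre_as_ideal"
| scale: "p \<in> pre_as_ideal \<Longrightarrow> magma_scale c p \<in> pre_as_ideal"
| mult_left: "p \<in> pre_as_ideal \<Longrightarrow> magma_mult a q p \<in> pre_as_ideal"
| mult_right: "p \<in> pre_as_ideal \<Longrightarrow> magma_mult a p q \<in> pre_as_ideal"
| rel1: "magma_mult White (magma_mult White x y) z + magma_mult White (magma_mult Black x y) z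
    - magma_mult White x (magma_mult White y z) + magma_mult Black (magma_mult Black x y) z
    - magma_mult Black x (magma_mult White y z) - magma_mult Black x (magma_mult Black y z)
    \<in> pre_as_ideal"
| rel2: "magma_mult White x (magma_mult Black y z) - magma_mult Black (magma_mult White x y) z
    \<in> pre_as_ideal"

lemma pre_as_ideal_uminus:
  assumes "p \<in> pre_as_ideal"
  shows "- p \<in> pre_as_ideal"
proof -
  have "magma_scale (- 1) p = - p" by (rule poly_mapping_eqI) simp
  then show ?thesis using pre_as_ideal.scale[OF assms, of "- 1"] by simp
qed

definition pre_as_cong :: "(dtree \<Rightarrow>\<^sub>0 'k::field) \<Rightarrow> (dtree \<Rightarrow>\<^sub>0 'k) \<Rightarrow> bool" where
  "pre_as_cong p q \<longleftrightarrow> p - q \<in> pre_as_ideal"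

quotient_type (overloaded) 'k free_pre_as = "dtree \<Rightarrow>\<^sub>0 'k::field" / pre_as_cong
proof (rule equivpI)
  show "reflp (pre_as_cong :: (dtree \<Rightarrow>\<^sub>0 'k) \<Rightarrow> _)"
    by (simp add: reflp_def pre_as_cong_def pre_as_ideal.zero)
  show "symp (pre_as_cong :: (dtree \<Rightarrow>\<^sub>0 'k) \<Rightarrow> _)"
    unfolding symp_def pre_as_cong_def using pre_as_ideal_uminus by (metis minus_diff_eq)
  show "transp (pre_as_cong :: (dtree \<Rightarrow>\<^sub>0 'k) \<Rightarrow> _)"
    unfolding transp_def pre_as_cong_def using pre_as_ideal.add by (metis diff_add_cancel add_diff_eq)
qed

instantiation free_pre_as :: (field) ab_group_add
begin

lift_definition zero_free_pre_as :: "'a free_pre_as" is 0 .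

lift_definition plus_free_pre_as :: "'a free_pre_as \<Rightarrow> 'a free_pre_as \<Rightarrow> 'a free_pre_as" is "(+)"
  unfolding pre_as_cong_def using pre_as_ideal.add by (metis add_diff_add)

lift_definition uminus_free_pre_as :: "'a free_pre_as \<Rightarrow> 'a free_pre_as" is uminus
  unfolding pre_as_cong_def using pre_as_ideal_uminus by (metis minus_diff_minus)

lift_definition minus_free_pre_as :: "'a free_pre_as \<Rightarrow> 'a free_pre_as \<Rightarrow> 'a free_pre_as" is "(-)"
  unfolding pre_as_cong_def
proof -
  fix p p' q q' :: "dtree \<Rightarrow>\<^sub>0 'a"
  assume "p - p' \<in> pre_as_ideal" "q - q' \<in> pre_as_ideal"
  then have "(p - p') + - (q - q') \<in> pre_as_ideal"
    by (intro pre_as_ideal.add pre_as_ideal_uminus)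
  then show "p - q - (p' - q') \<in> pre_as_ideal" by (simp add: algebra_simps)
qed

instance
proof
  fix a b c :: "'a free_pre_as"
  show "a + b + c = a + (b + c)"
    by transfer (simp add: pre_as_cong_def pre_as_ideal.zero add.assoc)
  show "a + b = b + a"
    by transfer (simp add: pre_as_cong_def pre_as_ideal.zero add.commute)
  show "0 + a = a" by transfer (simp add: pre_as_cong_def pre_as_ideal.zero)
  show "- a + a = 0" by transfer (simp add: pre_as_cong_def pre_as_ideal.zero)
  show "a - b = a + - b" by transfer (simp add: pre_as_cong_def pre_as_ideal.zero)
qed

end

lift_definition free_scale :: "'k::field \<Rightarrow> 'k free_pre_as \<Rightarrow> 'k free_pre_as" is magma_scale
proof -
  fix c :: 'k and p q :: "dtree \<Rightarrow>\<^sub>0 'k"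
  assume "pre_as_cong p q"
  moreover have "magma_scale c p - magma_scale c q = magma_scale c (p - q)"
    by (rule poly_mapping_eqI) (simp add: lookup_minus algebra_simps)
  ultimately show "pre_as_cong (magma_scale c p) (magma_scale c q)"
    by (simp add: pre_as_cong_def pre_as_ideal.scale)
qed

lift_definition free_mult ::
  "label \<Rightarrow> 'k::field free_pre_as \<Rightarrow> 'k free_pre_as \<Rightarrow> 'k free_pre_as" is magma_mult
proof -
  fix a :: label and p p' q q' :: "dtree \<Rightarrow>\<^sub>0 'k"
  assume "pre_as_cong p p'" "pre_as_cong q q'"
  then have "magma_mult a (p - p') q + magma_mult a p' (q - q') \<in> pre_as_ideal"
    unfolding pre_as_cong_def
    by (intro pre_as_ideal.add pre_as_ideal.mult_left pre_as_ideal.mult_right)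
  then show "pre_as_cong (magma_mult a p q) (magma_mult a p' q')"
    by (simp add: pre_as_cong_def magma_mult_bilinear)
qed

abbreviation free_lprod :: "'k::field free_pre_as \<Rightarrow> 'k free_pre_as \<Rightarrow> 'k free_pre_as" where
  "free_lprod \<equiv> free_mult Black"

abbreviation free_rprod :: "'k::field free_pre_as \<Rightarrow> 'k free_pre_as \<Rightarrow> 'k free_pre_as" where
  "free_rprod \<equiv> free_mult White"

lift_definition free_gen :: "'k::field free_pre_as" is "Poly_Mapping.single Leaf 1" .

lemma pre_as_cong_refl: "pre_as_cong p p"
  by (simp add: pre_as_cong_def pre_as_ideal.zero)

lemma free_vector_space: "vector_space (free_scale :: 'k::field \<Rightarrow> _)"
proof -
  interpret M: vector_space "magma_scale :: 'k \<Rightarrow> _" by (rule magma_vector_space)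
  show ?thesis
    by unfold_locales
      (transfer, simp add: pre_as_cong_refl M.scale_right_distrib M.scale_left_distrib)+
qed

lemma linear_intro:
  assumes "vector_space s1" "vector_space s2"
    and "\<And>x y. f (x + y) = f x + f y" "\<And>c x. f (s1 c x) = s2 c (f x)"
  shows "Vector_Spaces.linear s1 s2 f"
  using assms
  by (simp add: linear_iff_module_hom module_hom_def module_hom_axioms_def
      module_iff_vector_space)

lemma linear_free_mult:
  fixes x y :: "'k::field free_pre_as"
  shows "Vector_Spaces.linear free_scale free_scale (\<lambda>y. free_mult a x y)"
    and "Vector_Spaces.linear free_scale free_scale (\<lambda>x. free_mult a x y)"
  by (rule linear_intro[OF free_vector_space free_vector_space];
      transfer; simp add: pre_as_cong_refl magma_mult_bilinear)+

theorem free_initial_pre_as: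
  "initial_pre_as (free_scale :: 'k::field \<Rightarrow> _) free_lprod free_rprod"
proof (intro initial_pre_as.intro initial_pre_as_axioms.intro free_vector_space linear_free_mult)
  fix x y z :: "'k free_pre_as"
  show "free_rprod (free_rprod x y) z + free_rprod (free_lprod x y) z
      - free_rprod x (free_rprod y z) + free_lprod (free_lprod x y) z
      - free_lprod x (free_rprod y z) - free_lprod x (free_lprod y z) = 0"
    by transfer (simp add: pre_as_cong_def pre_as_ideal.rel1)
  show "free_rprod x (free_lprod y z) = free_lprod (free_rprod x y) z"
    by transfer (simp add: pre_as_cong_def pre_as_ideal.rel2)
qed


subsection \<open>Universal property\<close>

context initial_pre_as
begin

definition magma_ext :: "'a \<Rightarrow> (dtree \<Rightarrow>\<^sub>0 'k) \<Rightarrow> 'a" where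
  "magma_ext x p = (\<Sum>t\<in>Poly_Mapping.keys p. scale (Poly_Mapping.lookup p t) (eval_tree (\<prec>) (\<succ>) x t))"

abbreviation op :: "label \<Rightarrow> 'a \<Rightarrow> 'a \<Rightarrow> 'a" where
  "op a \<equiv> (case a of Black \<Rightarrow> (\<prec>) | White \<Rightarrow> (\<succ>))"

lemma linear_op: "Vector_Spaces.linear scale scale (\<lambda>y. op a x y)"
  "Vector_Spaces.linear scale scale (\<lambda>x. op a x y)"
  by (cases a; simp add: linear_lprod linear_rprod)+

lemma magma_ext_superset:
  "finite T \<Longrightarrow> Poly_Mapping.keys p \<subseteq> T \<Longrightarrow>
    magma_ext x p = (\<Sum>t\<in>T. scale (Poly_Mapping.lookup p t) (eval_tree (\<prec>) (\<succ>) x t))"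
  unfolding magma_ext_def by (rule sum.mono_neutral_left) (auto simp: in_keys_iff)

lemma magma_ext_add: "magma_ext x (p + q) = magma_ext x p + magma_ext x q"
proof -
  let ?T = "Poly_Mapping.keys p \<union> Poly_Mapping.keys q"
  have "finite ?T" "Poly_Mapping.keys (p + q) \<subseteq> ?T" by (auto simp: in_keys_iff lookup_add)
  then show ?thesis
    by (simp add: magma_ext_superset[of ?T] lookup_add scale_left_distrib sum.distrib)
qed

lemma magma_ext_scale: "magma_ext x (magma_scale c p) = scale c (magma_ext x p)"
proof -
  have "Poly_Mapping.keys (magma_scale c p) \<subseteq> Poly_Mapping.keys p" by (auto simp: in_keys_iff)
  then show ?thesis
    by (simp add: magma_ext_superset[of "Poly_Mapping.keys p"] scale_sum_right)
qed

lemma magma_ext_diff: "magma_ext x (p - q) = magma_ext x p - magma_ext x q"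
  using magma_ext_add[of x "p - q" q] by simp

lemma magma_ext_mult: "magma_ext x (magma_mult a p q) = op a (magma_ext x p) (magma_ext x q)"
proof -
  let ?e = "eval_tree (\<prec>) (\<succ>) x"
  let ?N = "\<lambda>(l, r). Node a l r"
  let ?T = "?N ` (Poly_Mapping.keys p \<times> Poly_Mapping.keys q)"
  have "Poly_Mapping.keys (magma_mult a p q) \<subseteq> ?T"
    by (auto simp: in_keys_iff lookup_magma_mult image_iff split: dtree.split_asm if_splits)
  then have "magma_ext x (magma_mult a p q) = (\<Sum>t\<in>?T. scale (Poly_Mapping.lookup (magma_mult a p q) t) (?e t))"
    by (intro magma_ext_superset) auto
  also have "\<dots> = (\<Sum>(l, r)\<in>Poly_Mapping.keys p \<times> Poly_Mapping.keys q.
      scale (Poly_Mapping.lookup p l * Poly_Mapping.lookup q r) (op a (?e l) (?e r)))"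
    by (subst sum.reindex) (auto simp: inj_on_def lookup_magma_mult intro!: sum.cong)
  also have "\<dots> = (\<Sum>l\<in>Poly_Mapping.keys p. scale (Poly_Mapping.lookup p l) (\<Sum>r\<in>Poly_Mapping.keys q.
      scale (Poly_Mapping.lookup q r) (op a (?e l) (?e r))))"
    by (simp add: sum.cartesian_product[symmetric] scale_sum_right)
  also have "\<dots> = (\<Sum>l\<in>Poly_Mapping.keys p. scale (Poly_Mapping.lookup p l) (op a (?e l) (magma_ext x q)))"
    unfolding magma_ext_def
    by (simp add: module_hom.sum[OF linear_op(1)[THEN Vector_Spaces.linear.axioms(3)]]
        module_hom.scale[OF linear_op(1)[THEN Vector_Spaces.linear.axioms(3)]])
  also have "\<dots> = op a (magma_ext x p) (magma_ext x q)"
    unfolding magma_ext_def[of x p]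
    by (simp add: module_hom.sum[OF linear_op(2)[THEN Vector_Spaces.linear.axioms(3)]]
        module_hom.scale[OF linear_op(2)[THEN Vector_Spaces.linear.axioms(3)]])
  finally show ?thesis .
qed

lemma magma_ext_single: "magma_ext x (Poly_Mapping.single t 1) = eval_tree (\<prec>) (\<succ>) x t"
  by (simp add: magma_ext_def)

lemma magma_ext_ideal: "p \<in> pre_as_ideal \<Longrightarrow> magma_ext x p = 0"
proof (induction rule: pre_as_ideal.induct)
  case zero
  show ?case by (simp add: magma_ext_def)
next
  case (mult_left p a q)
  then show ?case
    by (simp add: magma_ext_mult
        module_hom.zero[OF linear_op(1)[THEN Vector_Spaces.linear.axioms(3)]])
next
  case (mult_right p a q)
  then show ?case
    by (simp add: magma_ext_mult
        module_hom.zero[OF linear_op(2)[THEN Vector_Spaces.linear.axioms(3)]])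
qed (simp_all add: magma_ext_add magma_ext_diff magma_ext_scale magma_ext_mult
      pre_as_rel1 pre_as_rel2)

end

lemma poly_mapping_dtree_induct [case_names zero add scale single]:
  fixes P :: "(dtree \<Rightarrow>\<^sub>0 'k::field) \<Rightarrow> bool"
  assumes "P 0" and "\<And>p q. P p \<Longrightarrow> P q \<Longrightarrow> P (p + q)"
    and "\<And>c p. P p \<Longrightarrow> P (magma_scale c p)" and "\<And>t. P (Poly_Mapping.single t 1)"
  shows "P p"
proof -
  have single: "P (Poly_Mapping.single t c)" for t c
  proof -
    have "Poly_Mapping.single t c = magma_scale c (Poly_Mapping.single t 1)"
      by (rule poly_mapping_eqI) (simp add: lookup_single when_def)
    then show ?thesis by (metis assms(3,4))
  qed
  have "P (\<Sum>t\<in>T. Poly_Mapping.single t (Poly_Mapping.lookup p t))" if "finite T" for T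
    using that by (induction T rule: finite_induct) (simp_all add: assms(1,2) single)
  moreover have "(\<Sum>t\<in>Poly_Mapping.keys p. Poly_Mapping.single t (Poly_Mapping.lookup p t)) = p"
    by (rule poly_mapping_eqI)
      (auto simp: lookup_sum lookup_single when_def sum.delta in_keys_iff)
  ultimately show ?thesis by (metis finite_keys)
qed

theorem free_pre_as_universal:
  fixes scale :: "'k::field \<Rightarrow> 'a::ab_group_add \<Rightarrow> 'a"
  assumes "initial_pre_as scale lp rp"
  shows "\<exists>!f. Vector_Spaces.linear free_scale scale f \<and>
    (\<forall>u v. f (free_lprod u v) = lp (f u) (f v)) \<and>
    (\<forall>u v. f (free_rprod u v) = rp (f u) (f v)) \<and> f free_gen = x"
proof -
  interpret A: initial_pre_as scale lp rp by fact
  define f where "f u = A.magma_ext x (rep_free_pre_as u)" for u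
  have f_abs: "f (abs_free_pre_as p) = A.magma_ext x p" for p
  proof -
    have "pre_as_cong (rep_free_pre_as (abs_free_pre_as p)) p"
      by (rule Quotient3_rep_abs[OF Quotient3_free_pre_as]) (rule pre_as_cong_refl)
    then have "A.magma_ext x (rep_free_pre_as (abs_free_pre_as p) - p) = 0"
      unfolding pre_as_cong_def by (rule A.magma_ext_ideal)
    then show ?thesis by (simp add: f_def A.magma_ext_diff)
  qed
  note abs_simps = plus_free_pre_as.abs_eq free_scale.abs_eq free_mult.abs_eq
  have add: "f (u + v) = f u + f v" for u v
    by (induction u rule: free_pre_as.abs_induct, induction v rule: free_pre_as.abs_induct)
      (simp add: abs_simps f_abs A.magma_ext_add)
  have scale: "f (free_scale c u) = scale c (f u)" for c u
    by (induction u rule: free_pre_as.abs_induct) (simp add: abs_simps f_abs A.magma_ext_scale)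
  have mult: "f (free_mult a u v) = A.op a (f u) (f v)" for a u v
    by (induction u rule: free_pre_as.abs_induct, induction v rule: free_pre_as.abs_induct)
      (simp add: abs_simps f_abs A.magma_ext_mult)
  have gen: "f free_gen = x"
    by (simp add: free_gen_def f_abs A.magma_ext_single)
  show ?thesis
  proof (rule ex1I[of _ f])
    show "Vector_Spaces.linear free_scale scale f \<and>
      (\<forall>u v. f (free_lprod u v) = lp (f u) (f v)) \<and>
      (\<forall>u v. f (free_rprod u v) = rp (f u) (f v)) \<and> f free_gen = x"
      by (auto intro!: linear_intro free_vector_space A.vector_space_axioms
          simp: add scale mult gen)
  next
    fix g :: "'k free_pre_as \<Rightarrow> 'a"
    assume g: "Vector_Spaces.linear free_scale scale g \<and>
      (\<forall>u v. g (free_lprod u v) = lp (g u) (g v)) \<and>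
      (\<forall>u v. g (free_rprod u v) = rp (g u) (g v)) \<and> g free_gen = x"
    then interpret G: Vector_Spaces.linear free_scale scale g by blast
    have "g (abs_free_pre_as p) = A.magma_ext x p" for p
    proof (induction p rule: poly_mapping_dtree_induct)
      case zero
      show ?case
        using G.zero by (simp add: zero_free_pre_as_def A.magma_ext_def)
    next
      case (add p q)
      then show ?case
        using G.add[of "abs_free_pre_as p" "abs_free_pre_as q"]
        by (simp add: abs_simps A.magma_ext_add)
    next
      case (scale c p)
      then show ?case
        using G.scale[of c "abs_free_pre_as p"] by (simp add: abs_simps A.magma_ext_scale)
    next
      case (single t)
      show ?case
      proof (induction t)
        case Leaf
        then show ?case using g by (simp add: free_gen_def A.magma_ext_single)
      next
        case (Node a l r)
        have "g (free_mult a u v) = A.op a (g u) (g v)" for u v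
          using g by (cases a) auto
        from this[of "abs_free_pre_as (Poly_Mapping.single l 1)"
            "abs_free_pre_as (Poly_Mapping.single r 1)"] Node
        show ?case
          by (simp add: abs_simps magma_mult_single A.magma_ext_single)
      qed
    qed
    then have "g (abs_free_pre_as p) = f (abs_free_pre_as p)" for p by (simp add: f_abs)
    then have "g u = f u" for u by (induction u rule: free_pre_as.abs_induct) simp
    then show "g = f" by blast
  qed
qed


section \<open>Admissible monomials\<close>

abbreviation monomial :: "dtree \<Rightarrow> 'k::field free_pre_as" where
  "monomial \<equiv> eval_tree free_lprod free_rprod free_gen"

definition admissible_monomials :: "'k::field free_pre_as set" where
  "admissible_monomials = monomial ` {t. admissible t}"

end

theory Submission
  imports Defs
begin

text \<open>Every tree containing a forbidden pattern is a combination of trees with the same number of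
  leaves but smaller \<open>weight\<close>: this is clear for the patterns \<open>\<bullet>(\<circ>(\<cdot>,\<cdot>),\<cdot>)\<close> and \<open>\<circ>(\<circ>(\<cdot>,\<cdot>),\<cdot>)\<close>, and
  for the third pattern one computes \<open>((x \<succ> y) \<succ> z) \<prec> w\<close> in two ways. So admissible monomials span.

  For independence, put \<open>x * y = x \<prec> y + x \<succ> y\<close>. The axioms say that \<open>*\<close> is associative and that
  \<open>(x * y) \<prec> z - x * (y \<prec> z) = (x \<prec> y) \<prec> z - x \<prec> (y \<prec> z)\<close>. In the free algebra on \<open>x\<^sub>1\<close> this suggests that
  \<open>*\<close> is free on the letters \<open>x\<^sub>1\<close>, \<open>x\<^sub>1 \<prec> a\<close> and \<open>(x\<^sub>1 \<prec> a) \<prec> b\<close>. Writing them \<open>[1,1]\<close>, \<open>[1,a]\<close>, \<open>[a,b]\<close>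
  and allowing all letters \<open>[a,b]\<close> with \<open>a\<close>, \<open>b\<close> arbitrary, possibly empty, words in letters, the
  product \<open>\<prec>\<close> is given by one formula (see \<open>prec_word\<close>) and defines an initial pre-associative
  algebra on the free associative algebra on these letters. There \<open>p \<succ> r = p * r - p \<prec> r\<close>, and all
  words of \<open>p \<prec> r\<close> are more deeply nested than the least nested one of \<open>p * r\<close>; thus admissible trees
  have pairwise distinct least nested words.\<close>

section \<open>An algebra of nested words\<close>

text \<open>\<open>Letter a b u\<close> is the word \<open>u\<close> preceded by the letter \<open>[a,b]\<close>.\<close>

datatype word = Empty | Letter word word word

text \<open>Additive notation makes convolution of functions on words the product of the free
  associative algebra.\<close>

instantiation word :: monoid_add
begin

definition zero_word :: word where "zero_word = Empty"

primrec plus_word :: "word \<Rightarrow> word \<Rightarrow> word" where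
  "plus_word Empty w = w"
| "plus_word (Letter a b u) w = Letter a b (plus_word u w)"

instance
proof
  fix u v w :: word
  show "u + v + w = u + (v + w)" by (induction u) simp_all
  show "0 + u = u" by (simp add: zero_word_def)
  show "u + 0 = u" by (induction u) (simp_all add: zero_word_def)
qed

end

lemma size_plus_word: "size (u + v) = size u + size (v :: word)"
  by (induction u) simp_all

section \<open>The free associative algebra on the letters\<close>

type_synonym 'k word_algebra = "word \<Rightarrow>\<^sub>0 'k"

abbreviation of_word :: "word \<Rightarrow> 'k::field word_algebra" where
  "of_word w \<equiv> Poly_Mapping.single w 1"

definition word_scale :: "'k::field \<Rightarrow> 'k word_algebra \<Rightarrow> 'k word_algebra" where
  "word_scale c v = Poly_Mapping.single 0 c * v"

lemma of_word_mult: "of_word u * of_word v = (of_word (u + v) :: 'k::field word_algebra)"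
  by (simp add: mult_single)

lemma of_word_Empty: "of_word Empty = (1 :: 'k::field word_algebra)"
  by (simp flip: zero_word_def)

lemma word_scale_of_word: "word_scale c (of_word s) = Poly_Mapping.single s c"
  by (simp add: word_scale_def mult_single)

lemma word_algebra_single_induct [case_names add single]:
  assumes add: "\<And>p q. P p \<Longrightarrow> P q \<Longrightarrow> P (p + q)"
    and single: "\<And>w c. P (Poly_Mapping.single w c)"
  shows "P (v :: 'k::field word_algebra)"
proof -
  have "P 0" using single by (metis single_zero)
  have "P (\<Sum>s\<in>S. Poly_Mapping.single s (Poly_Mapping.lookup v s))" if "finite S" for S
    using that by (induction S rule: finite_induct) (simp_all add: \<open>P 0\<close> add single)
  moreover have "(\<Sum>s\<in>Poly_Mapping.keys v. Poly_Mapping.single s (Poly_Mapping.lookup v s)) = v"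
    by (rule poly_mapping_eqI)
      (auto simp: lookup_sum lookup_single when_def sum.delta in_keys_iff)
  ultimately show ?thesis by (metis finite_keys)
qed

lemma word_algebra_induct [case_names add scale of_word]:
  assumes "\<And>p q. P p \<Longrightarrow> P q \<Longrightarrow> P (p + q)"
    and scale: "\<And>c p. P p \<Longrightarrow> P (word_scale c p)"
    and of_word: "\<And>w. P (of_word w)"
  shows "P (v :: 'k::field word_algebra)"
proof (rule word_algebra_single_induct[of P])
  show "P (Poly_Mapping.single w c)" for w c
    using scale[OF of_word] by (metis word_scale_of_word)
qed (rule assms(1))

lemma word_scale_central:
  "v * Poly_Mapping.single 0 c = Poly_Mapping.single 0 c * (v :: 'k::field word_algebra)"
  by (induction v rule: word_algebra_single_induct) (simp_all add: algebra_simps mult_single)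

lemma word_scale_mult:
  "word_scale c v * w = word_scale c (v * w)"
  "v * word_scale c w = word_scale c (v * w)"
  by (simp add: word_scale_def mult.assoc)
    (simp add: word_scale_def word_scale_central flip: mult.assoc)

lemma word_vector_space: "vector_space (word_scale :: 'k::field \<Rightarrow> _)"
  by unfold_locales
    (simp_all add: word_scale_def distrib_left distrib_right single_add mult_single flip: mult.assoc)

interpretation W: vector_space "word_scale :: 'k::field \<Rightarrow> _"
  by (rule word_vector_space)

lemma lookup_word_scale [simp]:
  "Poly_Mapping.lookup (word_scale c v) w = c * Poly_Mapping.lookup v w"
  by (induction v rule: word_algebra_single_induct)
    (simp_all add: word_scale_def distrib_left lookup_add mult_single lookup_single when_def)

section \<open>Linear extension from words\<close>

definition word_lift :: "(word \<Rightarrow> 'k::field word_algebra) \<Rightarrow> 'k word_algebra \<Rightarrow> 'k word_algebra" where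
  "word_lift F v = (\<Sum>s\<in>Poly_Mapping.keys v. word_scale (Poly_Mapping.lookup v s) (F s))"

lemma word_lift_superset:
  "finite S \<Longrightarrow> Poly_Mapping.keys v \<subseteq> S \<Longrightarrow>
    word_lift F v = (\<Sum>s\<in>S. word_scale (Poly_Mapping.lookup v s) (F s))"
  unfolding word_lift_def by (rule sum.mono_neutral_left) (auto simp: in_keys_iff)

lemma word_lift_add: "word_lift F (v + w) = word_lift F v + word_lift F w"
proof -
  let ?S = "Poly_Mapping.keys v \<union> Poly_Mapping.keys w"
  have "finite ?S" "Poly_Mapping.keys (v + w) \<subseteq> ?S" by (auto simp: in_keys_iff lookup_add)
  then show ?thesis
    by (simp add: word_lift_superset[of ?S] lookup_add W.scale_left_distrib sum.distrib)
qed

lemma word_lift_scale: "word_lift F (word_scale c v) = word_scale c (word_lift F v)"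
proof -
  have "Poly_Mapping.keys (word_scale c v) \<subseteq> Poly_Mapping.keys v" by (auto simp: in_keys_iff)
  then show ?thesis
    by (simp add: word_lift_superset[of "Poly_Mapping.keys v"] W.scale_sum_right)
qed

lemma word_lift_of_word [simp]: "word_lift F (of_word s) = F s"
  by (simp add: word_lift_def)

lemma word_lift_fun_add: "word_lift (\<lambda>s. F s + G s) v = word_lift F v + word_lift G v"
  by (simp add: word_lift_def W.scale_right_distrib sum.distrib)

lemma word_lift_fun_scale: "word_lift (\<lambda>s. word_scale c (F s)) v = word_scale c (word_lift F v)"
  by (simp add: word_lift_def W.scale_sum_right mult.commute)

definition letter :: "'k::field word_algebra \<Rightarrow> 'k word_algebra \<Rightarrow> 'k word_algebra" where
  "letter v w = word_lift (\<lambda>s. word_lift (\<lambda>t. of_word (Letter s t 0)) w) v"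

lemma letter_add:
  "letter (v + v') w = letter v w + letter v' w"
  "letter v (w + w') = letter v w + letter v w'"
  by (simp_all add: letter_def word_lift_add word_lift_fun_add)

lemma letter_scale:
  "letter (word_scale c v) w = word_scale c (letter v w)"
  "letter v (word_scale c w) = word_scale c (letter v w)"
  by (simp_all add: letter_def word_lift_scale word_lift_fun_scale)

lemma letter_diff:
  "letter (v - v') w = letter v w - letter v' w"
  "letter v (w - w') = letter v w - letter v w'"
  using letter_add(1)[of "v - v'" v' w] letter_add(2)[of v "w - w'" w']
  by (simp_all add: eq_diff_eq)

lemma letter_of_word [simp]: "letter (of_word s) (of_word t) = of_word (Letter s t 0)"
  by (simp add: letter_def)

text \<open>The formula comes from the identity for \<open>(x * y) \<prec> z\<close> with \<open>x = [a,b]\<close> and \<open>y = u\<close>, by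
  expanding \<open>([a,b] \<prec> u) \<prec> z\<close> with the same identity for \<open>b\<close> and \<open>u\<close>.\<close>

function prec_word :: "word \<Rightarrow> 'k::field word_algebra \<Rightarrow> 'k word_algebra" where
  "prec_word Empty z = 0"
| "prec_word (Letter a b u) z =
    of_word (Letter a b 0) * prec_word u z
    + letter (of_word a) (prec_word (b + u) z - of_word b * prec_word u z)
    + letter (of_word (a + b + u)) z
    - letter 1 (of_word a * prec_word (b + u) z)"
  by pat_completeness auto
termination
  \<comment> \<open>\<open>size\<close> counts the letters at every depth, so \<open>u\<close> and
    \<open>b + u\<close> both lose at least the outer letter.\<close>
  by (relation "measure (size \<circ> fst)") (auto simp: size_plus_word)

declare prec_word.simps(2) [simp del]

lemma prec_word_add: "prec_word s (z + z') = prec_word s z + prec_word s z'"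
  by (induction s z rule: prec_word.induct)
    (simp_all add: prec_word.simps(2) letter_add letter_diff algebra_simps)

lemma prec_word_scale: "prec_word s (word_scale c z) = word_scale c (prec_word s z)"
  by (induction s z rule: prec_word.induct)
    (simp_all add: prec_word.simps(2) letter_add letter_diff letter_scale word_scale_mult
      W.scale_right_distrib W.scale_right_diff_distrib algebra_simps)

section \<open>The product \<open>prec\<close> and the axioms\<close>

definition prec :: "'k::field word_algebra \<Rightarrow> 'k word_algebra \<Rightarrow> 'k word_algebra" where
  "prec v z = word_lift (\<lambda>s. prec_word s z) v"

lemma prec_add:
  "prec (v + v') w = prec v w + prec v' w"
  "prec v (w + w') = prec v w + prec v w'"
  by (simp_all add: prec_def word_lift_add word_lift_fun_add prec_word_add)

lemma prec_scale:
  "prec (word_scale c v) w = word_scale c (prec v w)"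
  "prec v (word_scale c w) = word_scale c (prec v w)"
  by (simp_all add: prec_def word_lift_scale word_lift_fun_scale prec_word_scale)

lemma prec_diff:
  "prec (v - v') w = prec v w - prec v' w"
  "prec v (w - w') = prec v w - prec v w'"
  using prec_add(1)[of "v - v'" v' w] prec_add(2)[of v "w - w'" w']
  by (simp_all add: eq_diff_eq)

lemma prec_of_word: "prec (of_word s) z = prec_word s z"
  by (simp add: prec_def)

lemma prec_0: "prec 0 w = 0"
  by (simp add: prec_def word_lift_def)

lemma prec_1: "prec 1 z = 0"
  using prec_of_word[of Empty z] by (simp add: of_word_Empty)

text \<open>All terms of the recursion are linear in the tail, so the tail may be any element
  \<open>v\<close>, such as a product \<open>u * y\<close>.\<close>

lemma prec_letter_mult:
  "prec (of_word (Letter a b 0) * v) z =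
    of_word (Letter a b 0) * prec v z
    + letter (of_word a) (prec (of_word b * v) z - of_word b * prec v z)
    + letter (of_word (a + b) * v) z
    - letter 1 (of_word a * prec (of_word b * v) z)"
proof (induction v rule: word_algebra_induct)
  case (of_word u)
  then show ?case
    by (simp add: of_word_mult prec_of_word prec_word.simps(2))
next
  case (add p q)
  show ?case
    unfolding distrib_left prec_add add by (simp add: letter_add letter_diff algebra_simps)
next
  case (scale c p)
  show ?case
    unfolding word_scale_mult prec_scale letter_scale scale
    by (simp add: letter_diff letter_scale W.scale_right_distrib W.scale_right_diff_distrib)
qed

lemma prec_letter:
  "prec (letter (of_word a) d) z =
    letter (of_word a) (prec d z) + letter (of_word a * d) z - letter 1 (of_word a * prec d z)"
proof (induction d rule: word_algebra_induct)
  case (add p q)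
  show ?case
    unfolding distrib_left prec_add letter_add add by (simp add: algebra_simps)
next
  case (of_word b)
  then show ?case
    using prec_letter_mult[of a b 1 z] by (simp add: of_word_mult prec_1)
next
  case (scale c p)
  show ?case
    unfolding word_scale_mult prec_scale letter_scale scale
    by (simp add: letter_diff letter_scale W.scale_right_distrib W.scale_right_diff_distrib)
qed

text \<open>For an empty first slot the outer two terms of \<open>prec_letter\<close> cancel; this
  gives \<open>[a,b]\<close> its intended meaning \<open>(x1 \<prec> a) \<prec> b\<close>.\<close>

lemma prec_letter_1: "prec (letter 1 d) z = letter d z"
  using prec_letter[of 0 d z] by (simp add: single_one)

text \<open>After expansion by \<open>prec_letter_mult\<close> both sides agree by the instances for
  \<open>u\<close> and \<open>b + u\<close>. The latter is not a tail of \<open>s\<close>, hence the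
  induction on size.\<close>

lemma prec_mult_of_word:
  "prec (of_word s * y) z = of_word s * prec y z + prec (prec (of_word s) y) z
    - prec (of_word s) (prec y z)"
proof (induction "size s" arbitrary: s rule: less_induct)
  case less
  show ?case
  proof (cases s)
    case Empty
    then show ?thesis
      by (simp add: of_word_Empty prec_1 prec_0)
  next
    case (Letter a b u)
    have s: "of_word s = of_word (Letter a b 0) * of_word u"
      by (simp add: Letter of_word_mult)
    \<comment> \<open>Both hypotheses are solved for the doubly nested product, so that rewriting
      removes it.\<close>
    have IH1: "prec (prec (of_word u) y) z =
        prec (of_word u * y) z - of_word u * prec y z + prec (of_word u) (prec y z)"
      using less[of u] by (simp add: Letter)
    have IH2: "prec (prec (of_word (b + u)) y) z =
        prec (of_word (b + u) * y) z - of_word (b + u) * prec y z + prec (of_word (b + u)) (prec y z)"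
      using less[of "b + u"] by (simp add: Letter size_plus_word)
    show ?thesis
      unfolding s mult.assoc prec_letter_mult
      by (simp add: prec_add prec_diff letter_add letter_diff prec_letter_mult
        prec_letter prec_letter_1 IH1 IH2 of_word_mult distrib_left right_diff_distrib
        add.assoc[where ?'a = word] flip: mult.assoc)
  qed
qed

lemma prec_mult: "prec (x * y) z = x * prec y z + prec (prec x y) z - prec x (prec y z)"
proof (induction x rule: word_algebra_induct)
  case (add p q)
  show ?case
    unfolding distrib_right prec_add add by (simp add: prec_add)
next
  case (scale c p)
  show ?case
    unfolding word_scale_mult prec_scale scale
    by (simp add: W.scale_right_distrib W.scale_right_diff_distrib)
qed (rule prec_mult_of_word)

definition succ :: "'k::field word_algebra \<Rightarrow> 'k word_algebra \<Rightarrow> 'k word_algebra" where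
  "succ v w = v * w - prec v w"

text \<open>As \<open>*\<close> is associative, expanding \<open>succ\<close> turns either relation
  into \<open>prec_mult\<close>.\<close>

theorem word_initial_pre_as:
  "initial_pre_as (word_scale :: 'k::field \<Rightarrow> _) prec succ"
proof (intro initial_pre_as.intro initial_pre_as_axioms.intro word_vector_space
    linear_intro[OF word_vector_space word_vector_space])
  fix x y z :: "'k word_algebra"
  show "succ x (prec y z) = prec (succ x y) z"
    by (simp add: succ_def prec_diff prec_mult)
  show "succ (succ x y) z + succ (prec x y) z - succ x (succ y z) + prec (prec x y) z
      - prec x (succ y z) - prec x (prec y z) = 0"
    by (simp add: succ_def prec_diff prec_mult algebra_simps)
qed (simp_all add: succ_def prec_add prec_scale word_scale_mult distrib_left distrib_right
    W.scale_right_diff_distrib)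

section \<open>Leading words\<close>

text \<open>The sum of the depths of all letters, where letters at top level have depth 0.\<close>

primrec nesting :: "word \<Rightarrow> nat" where
  "nesting Empty = 0"
| "nesting (Letter a b u) = nesting a + nesting b + nesting u + size a + size b"

section \<open>Bounds on size and nesting\<close>

lemma zero_word_simps [simp]: "size (0 :: word) = 0" "nesting 0 = 0"
  by (simp_all add: zero_word_def)

lemma nesting_plus_word: "nesting (u + v) = nesting u + nesting v"
  by (induction u) simp_all

definition graded :: "nat \<Rightarrow> nat \<Rightarrow> 'k::field word_algebra \<Rightarrow> bool" where
  "graded n k v \<longleftrightarrow> (\<forall>w\<in>Poly_Mapping.keys v. size w = n \<and> k \<le> nesting w)"

lemma graded_mono: "graded n k v \<Longrightarrow> n = n' \<Longrightarrow> k' \<le> k \<Longrightarrow> graded n' k' v"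
  by (auto simp: graded_def)

lemma graded_add: "graded n k v \<Longrightarrow> graded n k w \<Longrightarrow> graded n k (v + w)"
  using keys_add[of v w] unfolding graded_def by blast

lemma graded_diff: "graded n k v \<Longrightarrow> graded n k w \<Longrightarrow> graded n k (v - w)"
  using keys_diff[of v w] unfolding graded_def by blast

lemma graded_0: "graded n k 0"
  by (simp add: graded_def)

lemma graded_of_word: "size w = n \<Longrightarrow> k \<le> nesting w \<Longrightarrow> graded n k (of_word w)"
  by (simp add: graded_def)

lemma graded_mult:
  assumes "graded m j v" "graded n k w"
  shows "graded (m + n) (j + k) (v * w)"
  unfolding graded_def
proof
  fix x assume "x \<in> Poly_Mapping.keys (v * w)"
  with keys_mult[of v w] obtain s t where "x = s + t"
    "s \<in> Poly_Mapping.keys v" "t \<in> Poly_Mapping.keys w" by blast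
  with assms show "size x = m + n \<and> j + k \<le> nesting x"
    by (auto simp: graded_def size_plus_word nesting_plus_word intro: add_mono)
qed

lemma graded_word_lift:
  assumes "\<And>s. s \<in> Poly_Mapping.keys v \<Longrightarrow> graded n k (F s)"
  shows "graded n k (word_lift F v)"
proof -
  have "Poly_Mapping.keys (word_lift F v) \<subseteq>
      (\<Union>s\<in>Poly_Mapping.keys v. Poly_Mapping.keys (word_scale (Poly_Mapping.lookup v s) (F s)))"
    unfolding word_lift_def by (rule keys_sum)
  moreover have "Poly_Mapping.keys (word_scale c u) \<subseteq> Poly_Mapping.keys u"
    for c and u :: "'a word_algebra"
    by (auto simp: in_keys_iff)
  ultimately show ?thesis using assms unfolding graded_def by blast
qed

lemma graded_letter:
  assumes "graded m j v" "graded n k w"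
  shows "graded (m + n + 1) (j + k + m + n) (letter v w)"
  unfolding letter_def
proof (intro graded_word_lift)
  fix s t assume "s \<in> Poly_Mapping.keys v" "t \<in> Poly_Mapping.keys w"
  with assms have "size s = m" "j \<le> nesting s" "size t = n" "k \<le> nesting t"
    by (auto simp: graded_def)
  then show "graded (m + n + 1) (j + k + m + n) (of_word (Letter s t 0))"
    by (intro graded_of_word) simp_all
qed

text \<open>The extra \<open>n\<close> arises because every letter of \<open>z\<close> ends up
  inside at least one more bracket, while no letter of \<open>s\<close> moves outwards.\<close>

lemma graded_prec_word:
  assumes "graded n k z"
  shows "graded (size s + n) (nesting s + k + n) (prec_word s z)"
  using assms
proof (induction s z rule: prec_word.induct)
  case (1 z)
  show ?case by (simp add: graded_0)
next
  case (2 a b u z)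
  note u = "2.IH"(1)[OF "2.prems"] and bu = "2.IH"(2)[OF "2.prems"]
  note w = graded_of_word[OF refl order_refl]
  have 0: "graded 0 0 (1 :: 'a word_algebra)" by (simp add: graded_def)
  let ?g = "graded (size (Letter a b u) + n) (nesting (Letter a b u) + k + n)"
  have "?g (of_word (Letter a b 0) * prec_word u z)"
    by (rule graded_mono[OF graded_mult[OF w u]]) auto
  moreover have "graded (size b + size u + n) (nesting b + nesting u + k + n)
      (prec_word (b + u) z - of_word b * prec_word u z)"
    by (intro graded_diff; rule graded_mono[OF bu] graded_mono[OF graded_mult[OF w u]])
      (auto simp: size_plus_word nesting_plus_word)
  then have "?g (letter (of_word a) (prec_word (b + u) z - of_word b * prec_word u z))"
    by (rule graded_mono[OF graded_letter[OF w]]) auto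
  moreover have "?g (letter (of_word (a + b + u)) z)"
    by (rule graded_mono[OF graded_letter[OF w "2.prems"]])
      (auto simp: size_plus_word nesting_plus_word)
  moreover have "?g (letter 1 (of_word a * prec_word (b + u) z))"
    by (rule graded_mono[OF graded_letter[OF 0 graded_mult[OF w bu]]])
      (auto simp: size_plus_word nesting_plus_word)
  ultimately show ?case
    unfolding prec_word.simps(2) by (intro graded_add graded_diff)
qed

lemma graded_prec:
  assumes "graded m j v" "graded n k z"
  shows "graded (m + n) (j + k + n) (prec v z)"
  unfolding prec_def
proof (rule graded_word_lift)
  fix s assume "s \<in> Poly_Mapping.keys v"
  with assms(1) have "size s = m" "j \<le> nesting s" by (auto simp: graded_def)
  then show "graded (m + n) (j + k + n) (prec_word s z)"
    by (intro graded_mono[OF graded_prec_word[OF assms(2)]]) auto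
qed

section \<open>Shape of admissible trees and their leading words\<close>

lemma admissible_Leaf: "admissible Leaf"
  by (simp add: admissible_def)

lemma admissible_Node:
  "admissible (Node c l r) \<longleftrightarrow> admissible l \<and> admissible r \<and>
    (\<forall>x y. l \<noteq> Node White x y) \<and> (\<forall>x y z. c = Black \<longrightarrow> l \<noteq> Node Black (Node Black x y) z)"
  unfolding admissible_def by (cases c) (auto; blast)+

text \<open>The left child of a black vertex is a leaf or a black vertex with a leaf on its left;
  anything else contains a forbidden pattern. As \<open>Black2\<close> skips a level, the induction
  is on size.\<close>

lemma admissible_induct [consumes 1, case_names Leaf Black Black2 White]:
  assumes "admissible t"
    and "P Leaf"
    and "\<And>a. admissible a \<Longrightarrow> P a \<Longrightarrow> P (Node Black Leaf a)"
    and "\<And>a b. admissible a \<Longrightarrow> admissible b \<Longrightarrow> P a \<Longrightarrow> P b \<Longrightarrow>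
      P (Node Black (Node Black Leaf a) b)"
    and "\<And>l r. admissible l \<Longrightarrow> admissible r \<Longrightarrow> (\<And>x y. l \<noteq> Node White x y) \<Longrightarrow> P l \<Longrightarrow> P r \<Longrightarrow>
      P (Node White l r)"
  shows "P t"
  using assms(1)
proof (induction "size t" arbitrary: t rule: less_induct)
  case less
  consider "t = Leaf" | l r where "t = Node White l r"
    | r where "t = Node Black Leaf r" | c x a b where "t = Node Black (Node c x a) b"
    by (metis dtree.exhaust label.exhaust)
  then show ?case
  proof cases
    case 1
    then show ?thesis using assms(2) by simp
  next
    case 2
    then show ?thesis using less by (auto simp: admissible_Node intro!: assms(5))
  next
    case 3
    then show ?thesis using less by (auto simp: admissible_Node intro!: assms(3))
  next
    case 4
    then have "c = Black" "x = Leaf"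
      using less.prems by (auto simp: admissible_Node) (metis dtree.exhaust label.exhaust)+
    then show ?thesis using less 4 by (auto simp: admissible_Node intro!: assms(4))
  qed
qed

primrec leaves :: "dtree \<Rightarrow> nat" where
  "leaves Leaf = 1"
| "leaves (Node c l r) = leaves l + leaves r"

text \<open>By \<open>admissible_induct\<close>, only the case \<open>c = Black\<close>, \<open>l = Leaf\<close> of the last equation matters.\<close>

fun lead :: "dtree \<Rightarrow> word" where
  "lead Leaf = Letter 0 0 0"
| "lead (Node White l r) = lead l + lead r"
| "lead (Node Black Leaf r) = Letter 0 (lead r) 0"
| "lead (Node Black (Node c l a) b) = Letter (lead a) (lead b) 0"

text \<open>A left inverse of \<open>lead\<close> on admissible trees. Leading words are never
  empty, so an empty slot marks an absent subtree.\<close>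

primrec unlead :: "word \<Rightarrow> dtree" where
  "unlead Empty = Leaf"
| "unlead (Letter a b u) =
    (let l = if b = 0 then Leaf else if a = 0 then Node Black Leaf (unlead b)
       else Node Black (Node Black Leaf (unlead a)) (unlead b)
     in if u = 0 then l else Node White l (unlead u))"

lemma lead_neq_0: "lead t \<noteq> 0"
proof (induction t rule: lead.induct)
  case (2 l r)
  then show ?case by (cases "lead l") (simp_all add: zero_word_def)
qed (simp_all add: zero_word_def)

lemma unlead_lead: "admissible t \<Longrightarrow> unlead (lead t) = t"
proof (induction rule: admissible_induct)
  case (White l r)
  \<comment> \<open>The left child is not white, so its leading word is a single letter, which shows
    where the concatenation splits.\<close>
  have "l = Leaf \<or> (\<exists>a. l = Node Black Leaf a) \<or> (\<exists>a b. l = Node Black (Node Black Leaf a) b)"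
    using White(1,3) by (induction rule: admissible_induct) auto
  with White(4,5) show ?case
    by (auto simp: lead_neq_0)
qed (simp_all add: lead_neq_0)

lemma inj_on_lead: "inj_on lead {t. admissible t}"
  by (rule inj_on_inverseI[of _ unlead]) (simp add: unlead_lead)

lemma size_lead: "admissible t \<Longrightarrow> size (lead t) = leaves t"
  by (induction rule: admissible_induct) (simp_all add: size_plus_word)

section \<open>Leading terms of admissible monomials\<close>

abbreviation word_monomial :: "dtree \<Rightarrow> 'k::field word_algebra" where
  "word_monomial \<equiv> eval_tree prec succ (of_word (Letter 0 0 0))"

lemma letter_1_of_word: "letter 1 (of_word w) = of_word (Letter 0 w 0)"
  using letter_of_word[of 0 w] by (simp add: single_one)

lemma prec_gen: "prec (of_word (Letter 0 0 0)) v = letter 1 v"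
  by (metis letter_1_of_word single_one prec_letter_1)

text \<open>Errors of the subtrees stay strictly deeper than the leading word, and at a white vertex
  the subtracted \<open>prec\<close> only adds deeper words.\<close>

lemma word_monomial_lead:
  "admissible t \<Longrightarrow>
    graded (leaves t) (nesting (lead t) + 1) (word_monomial t - of_word (lead t) :: 'k::field word_algebra)"
proof (induction rule: admissible_induct)
  case Leaf
  show ?case by (simp add: graded_0)
next
  case (Black a)
  have "word_monomial (Node Black Leaf a) - of_word (lead (Node Black Leaf a)) =
      (letter 1 (word_monomial a - of_word (lead a)) :: 'k word_algebra)"
    by (simp add: prec_gen letter_diff letter_1_of_word)
  moreover have "graded (leaves (Node Black Leaf a)) (nesting (lead (Node Black Leaf a)) + 1) \<dots>"
    by (rule graded_mono[OF graded_letter[OF _ Black(2)], of 0 0])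
      (auto simp: graded_def size_lead Black(1))
  ultimately show ?case by simp
next
  case (Black2 a b)
  let ?t = "Node Black (Node Black Leaf a) b"
  have b: "graded (leaves b) (nesting (lead b)) (word_monomial b :: 'k word_algebra)"
    using graded_add[OF graded_mono[OF Black2(4)], of _ _ "of_word (lead b)"]
    by (simp add: graded_of_word size_lead Black2(2))
  have "word_monomial ?t - of_word (lead ?t) =
      (letter (word_monomial a - of_word (lead a)) (word_monomial b)
       + letter (of_word (lead a)) (word_monomial b - of_word (lead b)) :: 'k word_algebra)"
    by (simp add: prec_gen prec_letter_1 letter_diff)
  moreover have "graded (leaves ?t) (nesting (lead ?t) + 1) \<dots>"
    by (intro graded_add graded_mono[OF graded_letter[OF Black2(3) b]]
        graded_mono[OF graded_letter[OF graded_of_word[OF refl order_refl] Black2(4)]])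
      (auto simp: size_lead Black2(1,2))
  ultimately show ?case by simp
next
  case (White l r)
  let ?t = "Node White l r"
  have full: "graded (leaves s) (nesting (lead s)) (word_monomial s :: 'k word_algebra)"
    if "s = l \<or> s = r" for s
    using that graded_add[OF graded_mono[OF White(4)], of _ _ "of_word (lead l)"]
      graded_add[OF graded_mono[OF White(5)], of _ _ "of_word (lead r)"]
    by (auto simp: graded_of_word size_lead White(1,2))
  \<comment> \<open>\<open>graded_prec\<close> gains \<open>leaves r\<close> in nesting; at least 1
    is required.\<close>
  have "leaves r > 0" by (induction r) auto
  have "word_monomial ?t - of_word (lead ?t) =
      (word_monomial l - of_word (lead l)) * word_monomial r
      + of_word (lead l) * (word_monomial r - of_word (lead r))
      - (prec (word_monomial l) (word_monomial r) :: 'k word_algebra)"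
    by (simp add: succ_def algebra_simps of_word_mult)
  moreover have "graded (leaves ?t) (nesting (lead ?t) + 1) \<dots>"
    by (intro graded_add graded_diff graded_mono[OF graded_mult[OF White(4) full]]
        graded_mono[OF graded_mult[OF graded_of_word[OF refl order_refl] White(5)]]
        graded_mono[OF graded_prec[OF full full]])
      (use \<open>leaves r > 0\<close> in \<open>auto simp: size_lead White(1,2) nesting_plus_word\<close>)
  ultimately show ?case by simp
qed

text \<open>All other words of \<open>word_monomial s\<close> are strictly deeper than
  \<open>lead s\<close>, hence than \<open>lead t\<close>, so \<open>lead t\<close> can only occur
  as \<open>lead s\<close>; and \<open>lead\<close> is injective.\<close>

lemma lookup_word_monomial:
  assumes "admissible s" "admissible t" "nesting (lead t) \<le> nesting (lead s)"
  shows "Poly_Mapping.lookup (word_monomial s :: 'k::field word_algebra) (lead t) = (if s = t then 1 else 0)"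
proof -
  have "lead t \<notin> Poly_Mapping.keys (word_monomial s - of_word (lead s) :: 'k word_algebra)"
    using word_monomial_lead[OF assms(1), where ?'k = 'k] assms(3)
    unfolding graded_def by (metis Suc_eq_plus1 Suc_n_not_le_n le_trans)
  then have "Poly_Mapping.lookup (word_monomial s - of_word (lead s) :: 'k word_algebra) (lead t) = 0"
    by (simp add: in_keys_iff)
  moreover have "lead s = lead t \<longleftrightarrow> s = t"
    using inj_on_lead assms(1,2) by (auto simp: inj_on_def)
  ultimately show ?thesis by (simp add: lookup_minus lookup_single when_def split: if_splits)
qed

lemma word_monomials_independent:
  assumes "finite T" "T \<subseteq> {t. admissible t}"
    and sum: "(\<Sum>t\<in>T. word_scale (c t) (word_monomial t)) = (0 :: 'k::field word_algebra)"
    and "t \<in> T"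
  shows "c t = 0"
proof (rule ccontr)
  assume "c t \<noteq> 0"
  with \<open>t \<in> T\<close> have "\<exists>t. t \<in> T \<and> c t \<noteq> 0" by blast
  \<comment> \<open>With nesting minimal among nonzero coefficients, \<open>lead m\<close> occurs in
    no other monomial that contributes to the sum.\<close>
  then obtain m where m: "m \<in> T" "c m \<noteq> 0"
    and min: "\<And>s. s \<in> T \<Longrightarrow> c s \<noteq> 0 \<Longrightarrow> nesting (lead m) \<le> nesting (lead s)"
    using ex_has_least_nat[of "\<lambda>t. t \<in> T \<and> c t \<noteq> 0" _ "\<lambda>t. nesting (lead t)"] by blast
  have "0 = (\<Sum>s\<in>T. c s * Poly_Mapping.lookup (word_monomial s :: 'k word_algebra) (lead m))"
    using arg_cong[OF sum, of "\<lambda>v. Poly_Mapping.lookup v (lead m)"] by (simp add: lookup_sum)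
  also have "\<dots> = (\<Sum>s\<in>T. if s = m then c m else 0)"
  proof (rule sum.cong[OF refl])
    fix s assume "s \<in> T"
    with m assms(2) have "admissible s" "admissible m" by auto
    with \<open>s \<in> T\<close> show "c s * Poly_Mapping.lookup (word_monomial s :: 'k word_algebra) (lead m)
        = (if s = m then c m else 0)"
      using lookup_word_monomial[of s m, where ?'k = 'k] min[of s]
      by (cases "c s = 0") auto
  qed
  also have "\<dots> = c m" using \<open>finite T\<close> m by simp
  finally show False using m by simp
qed

section \<open>Rewriting to admissible trees\<close>

text \<open>Twice the leaves in the left subtree, summed over all vertices, plus the number of white
  vertices. The factor 2 lets a leaf that quits a left subtree pay for a new white vertex.\<close>

primrec weight :: "dtree \<Rightarrow> nat" where
  "weight Leaf = 0"
| "weight (Node c l r) = weight l + weight r + 2 * leaves l + (if c = White then 1 else 0)"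

lemma leaves_pos [simp]: "0 < leaves t"
  by (induction t) auto

text \<open>The weight of a parent counts leaves on its left; keeping their number fixed lets a drop
  in a subtree propagate upwards.\<close>

definition lighter :: "dtree \<Rightarrow> dtree set" where
  "lighter t = {s. leaves s = leaves t \<and> weight s < weight t}"

lemma lighter_Node:
  "s \<in> lighter l \<Longrightarrow> Node c s r \<in> lighter (Node c l r)"
  "s \<in> lighter r \<Longrightarrow> Node c l s \<in> lighter (Node c l r)"
  by (auto simp: lighter_def)

context initial_pre_as
begin

lemma op_add: "op c (x + y) z = op c x z + op c y z" "op c x (y + z) = op c x y + op c x z"
  using linear_op[THEN Vector_Spaces.linear.axioms(3), THEN module_hom.add] by metis+

lemma op_diff: "op c (x - y) z = op c x z - op c y z" "op c x (y - z) = op c x y - op c x z"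
  using op_add(1)[of c "x - y" y z] op_add(2)[of c x "y - z" z] by (simp_all add: eq_diff_eq)

lemmas prod_add = op_add[of Black, simplified] op_add[of White, simplified]
lemmas prod_diff = op_diff[of Black, simplified] op_diff[of White, simplified]

lemma rprod_rprod:
  "(x \<succ> y) \<succ> z = x \<succ> (y \<succ> z) - (x \<prec> y) \<succ> z - (x \<prec> y) \<prec> z + x \<prec> (y \<succ> z) + x \<prec> (y \<prec> z)"
  using pre_as_rel1[of x y z] by (simp add: algebra_simps)

lemma lprod_lprod_lprod:
  "((x \<prec> y) \<prec> z) \<prec> w =
    (x \<prec> (y \<succ> z)) \<prec> w + (x \<prec> (y \<prec> z)) \<prec> w + (x \<prec> y) \<prec> (z \<prec> w)
    - x \<prec> (y \<succ> (z \<prec> w)) - x \<prec> (y \<prec> (z \<prec> w))"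
proof -
  \<comment> \<open>Expanding by \<open>rprod_rprod\<close> at \<open>x, y, z\<close> on the left
    and at \<open>x, y, z \<prec> w\<close> on the right, the terms with \<succ> outermost cancel by
    \<open>pre_as_rel2\<close>.\<close>
  have "((x \<succ> y) \<succ> z) \<prec> w = (x \<succ> y) \<succ> (z \<prec> w)"
    by (simp add: pre_as_rel2)
  then show ?thesis
    unfolding rprod_rprod by (simp add: prod_add prod_diff pre_as_rel2[symmetric] algebra_simps)
qed

abbreviation eval_at :: "'a \<Rightarrow> dtree \<Rightarrow> 'a" where
  "eval_at \<equiv> eval_tree (\<prec>) (\<succ>)"

lemma span_linear:
  assumes "Vector_Spaces.linear scale scale f" "v \<in> span S" "f ` S \<subseteq> span T"
  shows "f v \<in> span T"
proof -
  interpret f: Vector_Spaces.linear scale scale f by fact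
  have "f v \<in> span (f ` S)" using assms(2) by (simp add: f.span_image)
  then show ?thesis using span_mono[OF assms(3)] by (auto simp: span_span)
qed

text \<open>A forbidden pattern lies in a child, where linearity carries the reduction up, or at the
  root, where one of three rewriting identities applies.\<close>

lemma eval_reducible:
  assumes "\<not> admissible t"
  shows "eval_at x t \<in> span (eval_at x ` lighter t)"
  using assms
proof (induction t)
  case Leaf
  then show ?case by (simp add: admissible_Leaf)
next
  case (Node c l r)
  have base: "eval_at x s \<in> span (eval_at x ` lighter (Node c l r))" if "s \<in> lighter (Node c l r)" for s
    using that by (intro span_base) simp
  consider "\<not> admissible l" | "\<not> admissible r" | a b where "l = Node White a b"
    | a b d where "c = Black" "l = Node Black (Node Black a b) d"
    using Node.prems by (auto simp: admissible_Node)
  then show ?case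
  proof cases
    case 1
    have "op c (eval_at x l) (eval_at x r) \<in> span (eval_at x ` lighter (Node c l r))"
      by (rule span_linear[OF linear_op(2) Node.IH(1)[OF 1]])
        (auto intro!: base[where s = "Node c _ r", simplified] lighter_Node)
    then show ?thesis by simp
  next
    case 2
    have "op c (eval_at x l) (eval_at x r) \<in> span (eval_at x ` lighter (Node c l r))"
      by (rule span_linear[OF linear_op(1) Node.IH(2)[OF 2]])
        (auto intro!: base[where s = "Node c l _", simplified] lighter_Node)
    then show ?thesis by simp
  next
    case 3
    show ?thesis
    proof (cases c)
      case Black
      have "eval_at x (Node c l r) = eval_at x (Node White a (Node Black b r))"
        by (simp add: Black 3 pre_as_rel2)
      moreover have "Node White a (Node Black b r) \<in> lighter (Node c l r)"
        by (simp add: Black 3 lighter_def)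
      ultimately show ?thesis by (metis base)
    next
      case White
      have "eval_at x (Node c l r) = eval_at x (Node White a (Node White b r))
          - eval_at x (Node White (Node Black a b) r) - eval_at x (Node Black (Node Black a b) r)
          + eval_at x (Node Black a (Node White b r)) + eval_at x (Node Black a (Node Black b r))"
        by (simp add: White 3 rprod_rprod)
      also have "\<dots> \<in> span (eval_at x ` lighter (Node c l r))"
        by (intro span_add span_diff base) (simp_all add: White 3 lighter_def)
      finally show ?thesis .
    qed
  next
    case 4
    have "eval_at x (Node c l r) =
        eval_at x (Node Black (Node Black a (Node White b d)) r)
        + eval_at x (Node Black (Node Black a (Node Black b d)) r)
        + eval_at x (Node Black (Node Black a b) (Node Black d r))
        - eval_at x (Node Black a (Node White b (Node Black d r)))
        - eval_at x (Node Black a (Node Black b (Node Black d r)))"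
      by (simp add: 4 lprod_lprod_lprod)
    \<comment> \<open>Of the five trees, the two with an additional white vertex gain 1 in weight
      from it but lose at least \<open>2 * leaves a\<close>.\<close>
    also have "\<dots> \<in> span (eval_at x ` lighter (Node c l r))"
      by (intro span_add span_diff base)
        (simp_all add: 4 lighter_def, use leaves_pos[of a] in linarith,
          use leaves_pos[of a] in linarith)
    finally show ?thesis .
  qed
qed

lemma eval_in_span_admissible: "eval_at x t \<in> span (eval_at x ` {t. admissible t})"
proof (induction "weight t" arbitrary: t rule: less_induct)
  case less
  show ?case
  proof (cases "admissible t")
    case True
    then show ?thesis by (intro span_base) simp
  next
    case False
    have "eval_at x ` lighter t \<subseteq> span (eval_at x ` {t. admissible t})"
      using less by (auto simp: lighter_def)
    then have "span (eval_at x ` lighter t) \<subseteq> span (eval_at x ` {t. admissible t})"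
      by (metis span_mono span_span)
    then show ?thesis using eval_reducible[OF False] by blast
  qed
qed

end

section \<open>Spanning in the free algebra\<close>

lemma abs_free_pre_as_single:
  "abs_free_pre_as (Poly_Mapping.single t 1) = (monomial t :: 'k::field free_pre_as)"
proof (induction t)
  case Leaf
  show ?case by (simp add: free_gen_def)
next
  case (Node c l r)
  then show ?case
    by (cases c) (simp_all add: free_mult.abs_eq magma_mult_single flip: Node)
qed

lemma span_monomial:
  "module.span free_scale (range monomial) = (UNIV :: 'k::field free_pre_as set)"
proof -
  interpret F: vector_space "free_scale :: 'k \<Rightarrow> _" by (rule free_vector_space)
  have "abs_free_pre_as p \<in> F.span (range monomial)" for p
  proof (induction p rule: poly_mapping_dtree_induct)
    case zero
    show ?case using F.span_zero by (simp add: zero_free_pre_as_def)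
  next
    case (add p q)
    then show ?case using F.span_add by (simp flip: plus_free_pre_as.abs_eq)
  next
    case (scale c p)
    then show ?case using F.span_scale by (simp flip: free_scale.abs_eq)
  next
    case (single t)
    show ?case by (simp add: abs_free_pre_as_single F.span_base)
  qed
  then have "u \<in> F.span (range monomial)" for u :: "'k free_pre_as"
    by (induction u rule: free_pre_as.abs_induct)
  then show ?thesis by blast
qed

lemma span_admissible_monomials:
  "module.span free_scale (admissible_monomials :: 'k::field free_pre_as set) = UNIV"
proof -
  interpret F: initial_pre_as "free_scale :: 'k \<Rightarrow> _" free_lprod free_rprod
    by (rule free_initial_pre_as)
  have "range monomial \<subseteq> F.span (admissible_monomials :: 'k free_pre_as set)"
    using F.eval_in_span_admissible by (auto simp: admissible_monomials_def)
  then show ?thesis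
    using F.span_mono span_monomial[where ?'k = 'k] by (metis F.span_span top.extremum_uniqueI)
qed

section \<open>The basis of admissible monomials\<close>

text \<open>The universal property gives a morphism to the word algebra that maps
  \<open>monomial t\<close> to \<open>word_monomial t\<close>, where independence is known.\<close>

lemma sum_monomial_eq_0:
  assumes "finite T" "T \<subseteq> {t. admissible t}"
    and "(\<Sum>t\<in>T. free_scale (c t) (monomial t)) = (0 :: 'k::field free_pre_as)"
    and "t \<in> T"
  shows "c t = 0"
proof -
  obtain f :: "'k free_pre_as \<Rightarrow> 'k word_algebra" where f: "Vector_Spaces.linear free_scale word_scale f"
      "\<And>u v. f (free_lprod u v) = prec (f u) (f v)" "\<And>u v. f (free_rprod u v) = succ (f u) (f v)"
      "f free_gen = of_word (Letter 0 0 0)"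
    using free_pre_as_universal[OF word_initial_pre_as] by blast
  interpret f: Vector_Spaces.linear free_scale word_scale f by (rule f)
  have "f (monomial t) = word_monomial t" for t
    by (induction t) (auto simp: f(2-4) split: label.split)
  then have "(\<Sum>t\<in>T. word_scale (c t) (word_monomial t)) = f (\<Sum>t\<in>T. free_scale (c t) (monomial t))"
    by (simp add: f.sum f.scale)
  then show ?thesis
    using word_monomials_independent[OF assms(1,2) _ assms(4), of c] assms(3) by (simp add: f.zero)
qed

lemma inj_on_monomial: "inj_on (monomial :: dtree \<Rightarrow> 'k::field free_pre_as) {t. admissible t}"
proof (rule inj_onI, rule ccontr)
  fix s t assume st: "s \<in> {t. admissible t}" "t \<in> {t. admissible t}"
    "(monomial s :: 'k free_pre_as) = monomial t" "s \<noteq> t"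
  interpret F: vector_space "free_scale :: 'k \<Rightarrow> _" by (rule free_vector_space)
  have "(\<Sum>r\<in>{s, t}. free_scale (if r = s then 1 else - 1) (monomial r)) = (0 :: 'k free_pre_as)"
    using st by simp
  from sum_monomial_eq_0[OF _ _ this, of s] st show False by simp
qed

lemma independent_admissible_monomials:
  "\<not> module.dependent free_scale (admissible_monomials :: 'k::field free_pre_as set)"
proof -
  interpret F: vector_space "free_scale :: 'k \<Rightarrow> _" by (rule free_vector_space)
  have "c u = 0" if S: "finite S" "S \<subseteq> admissible_monomials" and u: "u \<in> S"
      and sum: "(\<Sum>v\<in>S. free_scale (c v) v) = 0" for S u and c :: "'k free_pre_as \<Rightarrow> 'k"
  proof -
    obtain T where T: "T \<subseteq> {t. admissible t}" "S = monomial ` T"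
      using S(2) unfolding admissible_monomials_def by (meson subset_image_iff)
    \<comment> \<open>Injectivity turns a relation indexed by elements into one indexed by
      trees.\<close>
    have inj: "inj_on (monomial :: _ \<Rightarrow> 'k free_pre_as) T"
      using inj_on_subset[OF inj_on_monomial T(1)] .
    have "finite T" using S(1) T(2) inj finite_image_iff by blast
    moreover have "(\<Sum>t\<in>T. free_scale (c (monomial t)) (monomial t)) = 0"
      using sum by (simp add: T(2) sum.reindex[OF inj])
    ultimately show ?thesis
      using sum_monomial_eq_0[of T "\<lambda>t. c (monomial t)"] T u by blast
  qed
  then show ?thesis unfolding F.independent_explicit_module by blast
qed

text \<open>Injectivity is stated separately because \<open>admissible_monomials\<close> is a set,
  which would merge equal monomials of distinct trees.\<close>

theorem corollary2:
  shows "inj_on (monomial :: dtree \<Rightarrow> 'k::field_char_0 free_pre_as) {t. admissible t}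
    \<and> \<not> module.dependent free_scale (admissible_monomials :: 'k free_pre_as set)
    \<and> module.span free_scale (admissible_monomials :: 'k free_pre_as set) = UNIV"
  by (intro conjI inj_on_monomial independent_admissible_monomials span_admissible_monomials)

end
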